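(* Let $n\geq 4$, let $R=\mathbb{Q}[x_1,\ldots,x_{n+2}]$, let $I_n=(x_1x_2,x_2x_3,\ldots,x_{n-1}x_n,x_nx_1)\subset R$ be the edge ideal of the $n$-cycle, let $J_n=(x_n,x_1)\cap\bigcap_{1\le i\le n-1}(x_i,x_{i+1})\subset R$ be the cover ideal of the $n$-cycle, and let $L_n=x_{n+1}I_n+x_{n+2}J_n\subset R$. Then $L_n$ is not normal.
   Context: For an ideal $I$ of a commutative ring $R$, an element $f\in R$ is integral over $I$ if there is an equation $f^k+c_1f^{k-1}+\cdots+c_{k-1}f+c_k=0$ with $c_i\in I^i$. The set $\overline{I}$ of elements integral over $I$ is the integral closure of $I$; $I$ is integrally closed if $I=\overline{I}$, and $I$ is normal if all powers $I^t$, $t\ge 1$, are integrally closed. *)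

theory Defs
  imports Complex_Main "HOL-Library.Poly_Mapping" "HOL-Algebra.Ideal_Product"
begin

section \<open>Integral closure of ideals\<close>

text \<open>For an ideal \<open>I\<close>, the \<open>t\<close>-th power is taken in the monoid \<^const>\<open>ideals_set\<close> of ideals
  under the ideal product; the zeroth power is the whole ring.\<close>

abbreviation ideal_power :: "('a, 'b) ring_scheme \<Rightarrow> 'a set \<Rightarrow> nat \<Rightarrow> 'a set"
  where "ideal_power R I t \<equiv> I [^]\<^bsub>ideals_set R\<^esub> t"

definition integral_over_ideal :: "('a, 'b) ring_scheme \<Rightarrow> 'a set \<Rightarrow> 'a \<Rightarrow> bool"
  where "integral_over_ideal R I f \<longleftrightarrow>
    (\<exists>k\<ge>1. \<exists>c. (\<forall>i\<in>{1..k}. c i \<in> ideal_power R I i) \<and>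
       f [^]\<^bsub>R\<^esub> k \<oplus>\<^bsub>R\<^esub> (\<Oplus>\<^bsub>R\<^esub>i\<in>{1..k}. c i \<otimes>\<^bsub>R\<^esub> f [^]\<^bsub>R\<^esub> (k - i)) = \<zero>\<^bsub>R\<^esub>)"

definition ideal_integral_closure :: "('a, 'b) ring_scheme \<Rightarrow> 'a set \<Rightarrow> 'a set"
  where "ideal_integral_closure R I = {f \<in> carrier R. integral_over_ideal R I f}"

definition integrally_closed_ideal :: "('a, 'b) ring_scheme \<Rightarrow> 'a set \<Rightarrow> bool"
  where "integrally_closed_ideal R I \<longleftrightarrow> I = ideal_integral_closure R I"

definition normal_ideal :: "('a, 'b) ring_scheme \<Rightarrow> 'a set \<Rightarrow> bool"
  where "normal_ideal R I \<longleftrightarrow> (\<forall>t\<ge>1. integrally_closed_ideal R (ideal_power R I t))"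


section \<open>Polynomial rings in finitely many variables\<close>

text \<open>A monomial is a finitely supported exponent function, a polynomial a finitely supported
  function from monomials to coefficients. The type has variables indexed by all of \<^typ>\<open>nat\<close>;
  the carrier keeps the polynomials in the variables \<open>x\<^sub>1, \<dots>, x\<^sub>N\<close> only.\<close>

definition mpoly_ring :: "nat \<Rightarrow> ((nat \<Rightarrow>\<^sub>0 nat) \<Rightarrow>\<^sub>0 'a::comm_ring_1) ring"
  where "mpoly_ring N =
    \<lparr>carrier = {p. \<forall>m\<in>Poly_Mapping.keys p. Poly_Mapping.keys m \<subseteq> {1..N}},
     mult = (*), one = 1, zero = 0, add = (+)\<rparr>"

definition var :: "nat \<Rightarrow> (nat \<Rightarrow>\<^sub>0 nat) \<Rightarrow>\<^sub>0 'a::comm_ring_1"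
  where "var i = Poly_Mapping.single (Poly_Mapping.single i 1) 1"

lemma cring_mpoly_ring: "cring (mpoly_ring N :: ((nat \<Rightarrow>\<^sub>0 nat) \<Rightarrow>\<^sub>0 'a::comm_ring_1) ring)"
proof (rule cringI)
  let ?R = "mpoly_ring N :: ((nat \<Rightarrow>\<^sub>0 nat) \<Rightarrow>\<^sub>0 'a) ring"
  have add: "p + q \<in> carrier ?R" if "p \<in> carrier ?R" "q \<in> carrier ?R" for p q
    using that Poly_Mapping.keys_add[of p q] by (auto simp: mpoly_ring_def)
  have mult: "p * q \<in> carrier ?R" if "p \<in> carrier ?R" "q \<in> carrier ?R" for p q
  proof -
    have "Poly_Mapping.keys m \<subseteq> {1..N}" if "m \<in> Poly_Mapping.keys (p * q)" for m
    proof -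
      from that Poly_Mapping.keys_mult[of p q] obtain a b where "m = a + b"
          "a \<in> Poly_Mapping.keys p" "b \<in> Poly_Mapping.keys q"
        by blast
      then show ?thesis
        using \<open>p \<in> _\<close> \<open>q \<in> _\<close> Poly_Mapping.keys_add[of a b] by (force simp: mpoly_ring_def)
    qed
    then show ?thesis by (simp add: mpoly_ring_def)
  qed
  have ops: "p \<oplus>\<^bsub>?R\<^esub> q = p + q" "p \<otimes>\<^bsub>?R\<^esub> q = p * q" "\<zero>\<^bsub>?R\<^esub> = 0" "\<one>\<^bsub>?R\<^esub> = 1" for p q
    by (simp_all add: mpoly_ring_def)
  have zero: "0 \<in> carrier ?R" and one: "1 \<in> carrier ?R"
    by (simp_all add: mpoly_ring_def)
  have uminus: "- p \<in> carrier ?R" if "p \<in> carrier ?R" for p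
    using that by (simp add: mpoly_ring_def)
  show "abelian_group ?R"
  proof (rule abelian_groupI, unfold ops)
    fix p q r assume p: "p \<in> carrier ?R" "q \<in> carrier ?R"
    show "p + q \<in> carrier ?R" using p by (rule add)
    show "p + q + r = p + (q + r)" "p + q = q + p" "0 + p = p"
      by (rule add.assoc add.commute add_0_left)+
    show "\<exists>q\<in>carrier ?R. q + p = 0"
      using uminus[OF p(1)] by (rule bexI[rotated]) (rule left_minus)
  qed (rule zero)
  show "comm_monoid ?R"
  proof (rule comm_monoidI, unfold ops)
    fix p q r assume p: "p \<in> carrier ?R" "q \<in> carrier ?R"
    show "p * q \<in> carrier ?R" using p by (rule mult)
    show "p * q * r = p * (q * r)" "p * q = q * p" "1 * p = p"
      by (rule mult.assoc mult.commute mult_1_left)+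
  qed (rule one)
qed (simp add: mpoly_ring_def distrib_right)

lemma var_in_carrier: "i \<in> {1..N} \<Longrightarrow> var i \<in> carrier (mpoly_ring N)"
  by (simp add: var_def mpoly_ring_def)


section \<open>The ideals of the cycle\<close>

abbreviation QX :: "nat \<Rightarrow> ((nat \<Rightarrow>\<^sub>0 nat) \<Rightarrow>\<^sub>0 rat) ring"
  where "QX \<equiv> mpoly_ring"

text \<open>All three ideals live in the ring with \<open>n + 2\<close> variables; the cycle has the vertices
  \<open>1, \<dots>, n\<close>.\<close>

definition cycle_edge_ideal :: "nat \<Rightarrow> ((nat \<Rightarrow>\<^sub>0 nat) \<Rightarrow>\<^sub>0 rat) set"
  where "cycle_edge_ideal n =
    Idl\<^bsub>QX (n + 2)\<^esub> ({var i \<otimes>\<^bsub>QX (n + 2)\<^esub> var (i + 1) | i. i \<in> {1..n - 1}}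
      \<union> {var n \<otimes>\<^bsub>QX (n + 2)\<^esub> var 1})"

definition cycle_cover_ideal :: "nat \<Rightarrow> ((nat \<Rightarrow>\<^sub>0 nat) \<Rightarrow>\<^sub>0 rat) set"
  where "cycle_cover_ideal n =
    Idl\<^bsub>QX (n + 2)\<^esub> {var n, var 1} \<inter> (\<Inter>i\<in>{1..n - 1}. Idl\<^bsub>QX (n + 2)\<^esub> {var i, var (i + 1)})"

definition cycle_sum_ideal :: "nat \<Rightarrow> ((nat \<Rightarrow>\<^sub>0 nat) \<Rightarrow>\<^sub>0 rat) set"
  where "cycle_sum_ideal n =
    (var (n + 1) <#\<^bsub>QX (n + 2)\<^esub> cycle_edge_ideal n)
      <+>\<^bsub>QX (n + 2)\<^esub> (var (n + 2) <#\<^bsub>QX (n + 2)\<^esub> cycle_cover_ideal n)"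

lemma (in cring) ideal_l_coset:
  assumes "ideal I R" "x \<in> carrier R"
  shows "ideal (x <# I) R"
proof -
  interpret I: ideal I R by fact
  show ?thesis
  proof (rule idealI)
    show "subgroup (x <# I) (add_monoid R)"
    proof (rule add.subgroupI)
      show "x <# I \<subseteq> carrier R"
        using assms(2) I.Icarr by (auto simp: l_coset_def)
      show "x <# I \<noteq> {}"
        using additive_subgroup.zero_closed[OF I.is_additive_subgroup]
        unfolding l_coset_def by blast
    next
      fix a assume "a \<in> x <# I"
      then obtain h where h: "h \<in> I" "a = x \<otimes> h" by (auto simp: l_coset_def)
      then have "\<ominus> a = x \<otimes> (\<ominus> h)" using assms(2) I.Icarr by (simp add: r_minus)
      then show "\<ominus> a \<in> x <# I" using h I.a_inv_closed by (auto simp: l_coset_def)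
    next
      fix a b assume "a \<in> x <# I" "b \<in> x <# I"
      then obtain h k where h: "h \<in> I" "a = x \<otimes> h" "k \<in> I" "b = x \<otimes> k"
        by (auto simp: l_coset_def)
      then have "a \<oplus> b = x \<otimes> (h \<oplus> k)" using assms(2) I.Icarr by (simp add: r_distr)
      then show "a \<oplus> b \<in> x <# I" using h I.a_closed by (auto simp: l_coset_def)
    qed
  next
    fix a r assume "a \<in> x <# I" and r: "r \<in> carrier R"
    then obtain h where h: "h \<in> I" "a = x \<otimes> h" by (auto simp: l_coset_def)
    have eq: "r \<otimes> a = x \<otimes> (r \<otimes> h)" "a \<otimes> r = x \<otimes> (r \<otimes> h)"
      using assms(2) r h I.Icarr by (simp_all add: m_ac)
    show "r \<otimes> a \<in> x <# I" "a \<otimes> r \<in> x <# I"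
      unfolding eq using I.I_l_closed[OF h(1) r] by (auto simp: l_coset_def)
  qed (rule ring_axioms)
qed

lemma
  assumes "n \<ge> 2"
  shows ideal_cycle_edge_ideal: "ideal (cycle_edge_ideal n) (QX (n + 2))"
    and ideal_cycle_cover_ideal: "ideal (cycle_cover_ideal n) (QX (n + 2))"
    and ideal_cycle_sum_ideal: "ideal (cycle_sum_ideal n) (QX (n + 2))"
proof -
  interpret cring "QX (n + 2)" by (rule cring_mpoly_ring)
  have v: "var i \<in> carrier (QX (n + 2))" if "i \<in> {1..n + 2}" for i
    using that by (rule var_in_carrier)
  have gen: "ideal (Idl\<^bsub>QX (n + 2)\<^esub> {var i, var j}) (QX (n + 2))"
    if "i \<in> {1..n + 2}" "j \<in> {1..n + 2}" for i j
    by (rule genideal_ideal) (use that v in auto)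
  show E: "ideal (cycle_edge_ideal n) (QX (n + 2))"
  proof -
    have "{var i \<otimes>\<^bsub>QX (n + 2)\<^esub> var (i + 1) | i. i \<in> {1..n - 1}} \<subseteq> carrier (QX (n + 2))"
    proof
      fix p assume "p \<in> {var i \<otimes>\<^bsub>QX (n + 2)\<^esub> var (i + 1) | i. i \<in> {1..n - 1}}"
      then obtain i where i: "p = var i \<otimes>\<^bsub>QX (n + 2)\<^esub> var (i + 1)" "i \<in> {1..n - 1}" by blast
      show "p \<in> carrier (QX (n + 2))"
        unfolding i(1) by (rule m_closed[OF v v]) (use i(2) assms in auto)
    qed
    moreover have "var n \<otimes>\<^bsub>QX (n + 2)\<^esub> var 1 \<in> carrier (QX (n + 2))"
      by (rule m_closed[OF v v]) (use assms in auto)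
    ultimately show ?thesis
      unfolding cycle_edge_ideal_def by (intro genideal_ideal Un_least) auto
  qed
  have "ideal (\<Inter>i\<in>{1..n - 1}. Idl\<^bsub>QX (n + 2)\<^esub> {var i, var (i + 1)}) (QX (n + 2))"
  proof (rule i_Intersect)
    fix I assume "I \<in> (\<lambda>i. Idl\<^bsub>QX (n + 2)\<^esub> {var i, var (i + 1)}) ` {1..n - 1}"
    then obtain i where i: "I = Idl\<^bsub>QX (n + 2)\<^esub> {var i, var (i + 1)}" "i \<in> {1..n - 1}" by blast
    show "ideal I (QX (n + 2))"
      unfolding i(1) by (rule gen) (use i(2) assms in auto)
  qed (use assms in auto)
  then show C: "ideal (cycle_cover_ideal n) (QX (n + 2))"
    unfolding cycle_cover_ideal_def by (intro i_intersect gen) (use assms in auto)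
  show "ideal (cycle_sum_ideal n) (QX (n + 2))"
    unfolding cycle_sum_ideal_def
    by (rule add_ideals[OF ideal_l_coset[OF E v] ideal_l_coset[OF C v]]) auto
qed

end

theory Submission
  imports Defs
begin

text \<open>Write \<open>a = x\<^bsub>n+1\<^esub>\<close> and \<open>b = x\<^bsub>n+2\<^esub>\<close>. The witness is \<open>g = a b x\<^sub>1 \<cdots> x\<^sub>n\<close>, which is integral
  over \<open>L\<^sup>2\<close> but not contained in it. Indeed \<open>g\<^sup>2\<close> is the product of the four elements \<open>a x\<^sub>1 x\<^sub>2\<close>,
  \<open>a x\<^sub>3 x\<^sub>4\<close>, \<open>b x\<^sub>1 x\<^sub>3 x\<^sub>5 \<cdots> x\<^sub>n\<close> and \<open>b x\<^sub>2 x\<^sub>4 x\<^sub>5 \<cdots> x\<^sub>n\<close> of \<open>L\<close>. If \<open>g\<close> were in \<open>L\<^sup>2\<close>, then, looking at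
  the exponents of \<open>a\<close> and \<open>b\<close>, the set of all vertices would be the disjoint union of a set
  containing an edge and a vertex cover; but the complement of a vertex cover is independent.\<close>

section \<open>Ideal powers and integral equations of degree two\<close>

lemma (in cring) ideal_power_one: "ideal I R \<Longrightarrow> ideal_power R I 1 = I"
  by (simp add: ideals_set_def nat_pow_def ideal_prod_commute[OF oneideal] ideal_prod_one)

lemma (in cring) ideal_power_two: "ideal I R \<Longrightarrow> ideal_power R I 2 = I \<cdot> I"
  by (simp add: ideals_set_def nat_pow_def numeral_2_eq_2 ideal_prod_commute[OF oneideal]
      ideal_prod_one)

text \<open>The element \<open>g\<close> is a root of the monic polynomial X^2 - g^2, whose
  coefficients 0 and -g^2 lie in I and I^2.\<close>

lemma (in cring) integral_over_idealI_square:
  assumes "ideal I R" "g \<in> carrier R" "g \<otimes> g \<in> I \<cdot> I"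
  shows "integral_over_ideal R I g"
proof -
  define c where "c i = (if i = 1 then \<zero> else \<ominus> (g \<otimes> g))" for i :: nat
  have I12: "{1..2} = {1, 2::nat}" by auto
  have "\<ominus> (g \<otimes> g) \<in> I \<cdot> I"
    using additive_subgroup.a_inv_closed[OF ideal.axioms(1)[OF ideal_prod_is_ideal]] assms by blast
  then have "c i \<in> ideal_power R I i" if "i \<in> {1..2}" for i
    using that additive_subgroup.zero_closed[OF ideal.axioms(1)[OF assms(1)]]
      ideal_power_one[OF assms(1)] ideal_power_two[OF assms(1)]
    unfolding I12 c_def by auto
  moreover have "(\<Oplus>i\<in>{1..2}. c i \<otimes> g [^] (2 - i)) = \<ominus> (g \<otimes> g)"
    unfolding I12 using assms(2) by (simp add: c_def)
  then have "g [^] (2::nat) \<oplus> (\<Oplus>i\<in>{1..2}. c i \<otimes> g [^] (2 - i)) = \<zero>"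
    using assms(2) by (simp add: numeral_2_eq_2 r_neg)
  ultimately show ?thesis
    unfolding integral_over_ideal_def by (intro exI[of _ 2] conjI exI[of _ c] ballI) auto
qed

section \<open>Ideal membership read off from exponents\<close>

lemma mpoly_ring_simps [simp]:
  "mult (mpoly_ring N) = (*)" "one (mpoly_ring N) = 1"
  "zero (mpoly_ring N) = 0" "add (mpoly_ring N) = (+)"
  by (simp_all add: mpoly_ring_def)

text \<open>Every monomial of a product \<open>r * p\<close> is a sum of exponent functions, one
  from \<open>r\<close> and one from \<open>p\<close>. A condition stable under adding exponents is
  thus inherited by all multiples, and sums create no new monomials.\<close>

lemma ideal_keys:
  assumes "\<And>m m'. P m \<Longrightarrow> P (m' + m)"
  shows "ideal {p \<in> carrier (mpoly_ring N :: ((nat \<Rightarrow>\<^sub>0 nat) \<Rightarrow>\<^sub>0 'a::comm_ring_1) ring).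
    \<forall>m\<in>Poly_Mapping.keys p. P m} (mpoly_ring N)"
    (is "ideal ?I ?R")
proof -
  interpret cring ?R by (rule cring_mpoly_ring)
  have mult: "r * p \<in> ?I" if "p \<in> ?I" "r \<in> carrier ?R" for p r
    using that Poly_Mapping.keys_mult[of r p] m_closed[of r p] assms by fastforce
  show ?thesis
  proof (rule idealI)
    show "subgroup ?I (add_monoid ?R)"
    proof (rule add.subgroupI)
      show "?I \<noteq> {}" using zero_closed by auto
    next
      fix p assume p: "p \<in> ?I"
      have "\<ominus>\<^bsub>?R\<^esub> p = - p"
        by (rule minus_equality) (use p in \<open>auto simp: mpoly_ring_def\<close>)
      then show "\<ominus>\<^bsub>?R\<^esub> p \<in> ?I" using p by (auto simp: mpoly_ring_def)
    next
      fix p q assume "p \<in> ?I" "q \<in> ?I"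
      then show "p \<oplus>\<^bsub>?R\<^esub> q \<in> ?I"
        using Poly_Mapping.keys_add[of p q] a_closed[of p q] by auto
    qed auto
  next
    fix p r assume "p \<in> ?I" "r \<in> carrier ?R"
    from mult[OF this] show "r \<otimes>\<^bsub>?R\<^esub> p \<in> ?I" "p \<otimes>\<^bsub>?R\<^esub> r \<in> ?I"
      by (simp_all add: mult.commute)
  qed (rule ring_axioms)
qed

text \<open>The generated ideal is the smallest one containing \<open>S\<close>, so it lies in the
  ideal of \<open>ideal_keys\<close>. This turns a condition on generators into a necessary
  condition for membership.\<close>

lemma keys_genideal:
  assumes "\<And>m m'. P m \<Longrightarrow> P (m' + m)" "S \<subseteq> carrier (mpoly_ring N)"
    and "\<And>p m. p \<in> S \<Longrightarrow> m \<in> Poly_Mapping.keys p \<Longrightarrow> P m"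
    and "p \<in> Idl\<^bsub>mpoly_ring N\<^esub> S" "m \<in> Poly_Mapping.keys p"
  shows "P m"
proof -
  interpret cring "mpoly_ring N :: ((nat \<Rightarrow>\<^sub>0 nat) \<Rightarrow>\<^sub>0 'a) ring" by (rule cring_mpoly_ring)
  show ?thesis
    using genideal_minimal[OF ideal_keys[of P N], of S] assms by fast
qed

lemma keys_var: "Poly_Mapping.keys (var i :: _ \<Rightarrow>\<^sub>0 'a::comm_ring_1) = {Poly_Mapping.single i 1}"
  by (simp add: var_def)

lemma keys_var_times:
  assumes "m \<in> Poly_Mapping.keys (var i * p :: _ \<Rightarrow>\<^sub>0 'a::comm_ring_1)"
  obtains m' where "m = Poly_Mapping.single i 1 + m'" "m' \<in> Poly_Mapping.keys p"
  using assms Poly_Mapping.keys_mult[of "var i" p] by (auto simp: keys_var)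

section \<open>Squarefree monomials\<close>

definition var_prod :: "nat set \<Rightarrow> (nat \<Rightarrow>\<^sub>0 nat) \<Rightarrow>\<^sub>0 'a::comm_ring_1"
  where "var_prod S = (\<Prod>i\<in>S. var i)"

lemma var_prod_carrier: "S \<subseteq> {1..N} \<Longrightarrow> var_prod S \<in> carrier (mpoly_ring N)"
proof (induction S rule: infinite_finite_induct)
  case (insert i S)
  interpret cring "mpoly_ring N :: ((nat \<Rightarrow>\<^sub>0 nat) \<Rightarrow>\<^sub>0 'a) ring" by (rule cring_mpoly_ring)
  show ?case
    using insert m_closed[OF var_in_carrier, of i "var_prod S"] by (simp add: var_prod_def)
qed (simp_all add: var_prod_def mpoly_ring_def)

lemma keys_var_prod:
  assumes "finite S"
  obtains m where "Poly_Mapping.keys (var_prod S :: _ \<Rightarrow>\<^sub>0 'a::comm_ring_1) = {m}"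
    "\<And>i. i \<in> S \<Longrightarrow> Poly_Mapping.lookup m i = 1"
proof
  have "var_prod S = (Poly_Mapping.single (\<Sum>i\<in>S. Poly_Mapping.single i 1) 1 :: _ \<Rightarrow>\<^sub>0 'a)"
    using assms by induction (simp_all add: var_prod_def var_def mult_single)
  then show "Poly_Mapping.keys (var_prod S :: _ \<Rightarrow>\<^sub>0 'a) = {\<Sum>i\<in>S. Poly_Mapping.single i 1}"
    by simp
  show "Poly_Mapping.lookup (\<Sum>i\<in>S. Poly_Mapping.single i 1) i = 1" if "i \<in> S" for i
    using that assms by (simp add: lookup_sum lookup_single when_def)
qed

text \<open>The factor \<open>var i\<close> splits off from the product and leaves a cofactor in the
  ring.\<close>

lemma var_prod_in_genideal:
  assumes "S \<subseteq> {1..N}" "i \<in> S" "var i \<in> G" "G \<subseteq> carrier (mpoly_ring N)"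
  shows "var_prod S \<in> Idl\<^bsub>mpoly_ring N\<^esub> (G :: (_ \<Rightarrow>\<^sub>0 'a::comm_ring_1) set)"
proof -
  interpret cring "mpoly_ring N :: ((nat \<Rightarrow>\<^sub>0 nat) \<Rightarrow>\<^sub>0 'a) ring" by (rule cring_mpoly_ring)
  have "finite S" using assms(1) finite_subset by blast
  then have "var_prod S = var_prod (S - {i}) \<otimes>\<^bsub>mpoly_ring N\<^esub> (var i :: _ \<Rightarrow>\<^sub>0 'a)"
    using assms(2) by (simp add: var_prod_def prod.remove mult.commute)
  moreover have "var_prod (S - {i}) \<in> carrier (mpoly_ring N :: (_ \<Rightarrow>\<^sub>0 'a) ring)"
    using assms(1) by (intro var_prod_carrier) auto
  moreover have "var i \<in> Idl\<^bsub>mpoly_ring N\<^esub> G"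
    using genideal_self[OF assms(4)] assms(3) by auto
  ultimately show ?thesis
    using ideal.I_l_closed[OF genideal_ideal[OF assms(4)]] by metis
qed

section \<open>Monomials occurring in the edge ideal, the cover ideal and L\<close>

text \<open>Each edge appears once, as an ordered pair. Including the closing edge
  \<open>(n, 1)\<close> lets one index set serve both the generators of the edge ideal and the
  components of the cover ideal.\<close>

definition cycle_edges :: "nat \<Rightarrow> (nat \<times> nat) set"
  where "cycle_edges n = insert (n, 1) {(i, i + 1) | i. i \<in> {1..n - 1}}"

lemma cycle_edges_bounds:
  assumes "n \<ge> 2" "(i, j) \<in> cycle_edges n"
  shows "i \<in> {1..n}" "j \<in> {1..n}"
  using assms by (auto simp: cycle_edges_def)

lemma cycle_edge_ideal_eq:
  "cycle_edge_ideal n = Idl\<^bsub>QX (n + 2)\<^esub> ((\<lambda>(i, j). var i * var j) ` cycle_edges n)"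
proof -
  have "{var i \<otimes>\<^bsub>QX (n + 2)\<^esub> var (i + 1) | i. i \<in> {1..n - 1}} \<union> {var n \<otimes>\<^bsub>QX (n + 2)\<^esub> var 1}
      = (\<lambda>(i, j). var i * var j) ` cycle_edges n"
    by (auto simp: cycle_edges_def image_iff)
  then show ?thesis by (simp only: cycle_edge_ideal_def)
qed

lemma edge_generators_carrier:
  assumes "n \<ge> 2"
  shows "(\<lambda>(i, j). var i * var j) ` cycle_edges n \<subseteq> carrier (QX (n + 2))"
proof -
  interpret cring "QX (n + 2)" by (rule cring_mpoly_ring)
  have "var i * var j \<in> carrier (QX (n + 2))" if "(i, j) \<in> cycle_edges n" for i j
    using m_closed[OF var_in_carrier var_in_carrier, of i j] cycle_edges_bounds[OF assms that]
    by simp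
  then show ?thesis by auto
qed

lemma keys_edge:
  assumes "n \<ge> 2" "p \<in> cycle_edge_ideal n" "m \<in> Poly_Mapping.keys p"
  shows "\<exists>(i, j)\<in>cycle_edges n. Poly_Mapping.lookup m i \<ge> 1 \<and> Poly_Mapping.lookup m j \<ge> 1"
    (is "?P m")
proof (rule keys_genideal[where P = ?P, OF _ edge_generators_carrier[OF assms(1)] _
      assms(2)[unfolded cycle_edge_ideal_eq] assms(3)])
  show "?P (m' + m)" if "?P m" for m m'
  proof -
    from that obtain i j where "(i, j) \<in> cycle_edges n"
        "Poly_Mapping.lookup m i \<ge> 1" "Poly_Mapping.lookup m j \<ge> 1"
      by blast
    then show ?thesis by (intro bexI[of _ "(i, j)"]) (simp_all add: lookup_add)
  qed
next
  fix p m
  assume p: "p \<in> (\<lambda>(i, j). var i * var j :: _ \<Rightarrow>\<^sub>0 rat) ` cycle_edges n"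
    and m: "m \<in> Poly_Mapping.keys p"
  then obtain i j where ij: "(i, j) \<in> cycle_edges n" "p = var i * var j"
    by auto
  then have "m = Poly_Mapping.single i 1 + Poly_Mapping.single j 1"
    using m by (auto elim!: keys_var_times simp: keys_var)
  then show "?P m" using ij(1) by (intro bexI[of _ "(i, j)"]) (simp_all add: lookup_add)
qed

text \<open>The cover ideal is contained in the prime (x_i, x_j) of each edge, and every monomial
  there is divisible by one of the two variables. Over all edges, the support of a monomial is a
  vertex cover.\<close>

lemma keys_cover:
  assumes "n \<ge> 2" "p \<in> cycle_cover_ideal n" "m \<in> Poly_Mapping.keys p"
    and "(i, j) \<in> cycle_edges n"
  shows "Poly_Mapping.lookup m i \<ge> 1 \<or> Poly_Mapping.lookup m j \<ge> 1"
    (is "?P m")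
proof (rule keys_genideal[where P = ?P and S = "{var i, var j}", OF _ _ _ _ assms(3)])
  show "p \<in> Idl\<^bsub>QX (n + 2)\<^esub> {var i, var j}"
    using assms(2,4) by (auto simp: cycle_cover_ideal_def cycle_edges_def)
  show "{var i, var j} \<subseteq> carrier (QX (n + 2))"
    using cycle_edges_bounds[OF assms(1,4)] by (auto intro!: var_in_carrier)
qed (auto simp: lookup_add keys_var)

lemma keys_cycle_sum:
  assumes "n \<ge> 2" "p \<in> cycle_sum_ideal n" "m \<in> Poly_Mapping.keys p"
  shows "Poly_Mapping.lookup m (n + 1) \<ge> 1 \<and>
      (\<exists>(i, j)\<in>cycle_edges n. Poly_Mapping.lookup m i \<ge> 1 \<and> Poly_Mapping.lookup m j \<ge> 1) \<or>
    Poly_Mapping.lookup m (n + 2) \<ge> 1 \<and>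
      (\<forall>(i, j)\<in>cycle_edges n. Poly_Mapping.lookup m i \<ge> 1 \<or> Poly_Mapping.lookup m j \<ge> 1)"
proof -
  obtain q r where "q \<in> cycle_edge_ideal n" "r \<in> cycle_cover_ideal n"
      "p = var (n + 1) * q + var (n + 2) * r"
    using assms(2) by (auto simp: cycle_sum_ideal_def set_add_def' l_coset_def)
  \<comment> \<open>Cancellation between the summands can only remove monomials, so each monomial of
    \<open>p\<close> comes from one of them.\<close>
  then have "m \<in> Poly_Mapping.keys (var (n + 1) * q) \<union> Poly_Mapping.keys (var (n + 2) * r)"
    using assms(3) subsetD[OF Poly_Mapping.keys_add] by metis
  then consider "m \<in> Poly_Mapping.keys (var (n + 1) * q)" | "m \<in> Poly_Mapping.keys (var (n + 2) * r)"
    by blast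
  then show ?thesis
  proof cases
    case 1
    then obtain m' where m': "m = Poly_Mapping.single (n + 1) 1 + m'" "m' \<in> Poly_Mapping.keys q"
      by (rule keys_var_times)
    obtain i j where "(i, j) \<in> cycle_edges n"
        "Poly_Mapping.lookup m' i \<ge> 1" "Poly_Mapping.lookup m' j \<ge> 1"
      using keys_edge[OF assms(1) \<open>q \<in> _\<close> m'(2)] by blast
    then show ?thesis
      by (intro disjI1 conjI bexI[of _ "(i, j)"]) (simp_all add: m'(1) lookup_add)
  next
    case 2
    then obtain m' where m': "m = Poly_Mapping.single (n + 2) 1 + m'" "m' \<in> Poly_Mapping.keys r"
      by (rule keys_var_times)
    have "Poly_Mapping.lookup m i \<ge> 1 \<or> Poly_Mapping.lookup m j \<ge> 1"
      if "(i, j) \<in> cycle_edges n" for i j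
      using keys_cover[OF assms(1) \<open>r \<in> _\<close> m'(2) that] by (auto simp: m'(1) lookup_add)
    moreover have "Poly_Mapping.lookup m (n + 2) \<ge> 1"
      by (simp add: m'(1) lookup_add)
    ultimately show ?thesis by blast
  qed
qed

section \<open>Explicit elements of L\<close>

lemma edge_in_cycle_sum:
  assumes "n \<ge> 2" "i \<in> {1..n - 1}"
  shows "var (n + 1) * (var i * var (i + 1)) \<in> cycle_sum_ideal n"
proof -
  interpret cring "QX (n + 2)" by (rule cring_mpoly_ring)
  have "var i * var (i + 1) \<in> cycle_edge_ideal n"
    unfolding cycle_edge_ideal_eq using assms(2)
    by (intro subsetD[OF genideal_self[OF edge_generators_carrier[OF assms(1)]]])
      (auto simp: cycle_edges_def)
  moreover have "0 \<in> cycle_cover_ideal n"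
    using additive_subgroup.zero_closed[OF ideal.axioms(1)[OF ideal_cycle_cover_ideal[OF assms(1)]]]
    by simp
  ultimately show ?thesis
    by (force simp: cycle_sum_ideal_def set_add_def' l_coset_def)
qed

text \<open>A vertex cover meets every edge, so its monomial is a multiple of an endpoint variable
  in each component of the cover ideal. The summand from the edge ideal is taken to be 0.\<close>

lemma cover_in_cycle_sum:
  assumes "n \<ge> 2" "S \<subseteq> {1..n}" "n \<in> S \<or> 1 \<in> S" "\<And>i. i \<in> {1..n - 1} \<Longrightarrow> i \<in> S \<or> i + 1 \<in> S"
  shows "var (n + 2) * var_prod S \<in> cycle_sum_ideal n"
proof -
  have gen: "var_prod S \<in> Idl\<^bsub>QX (n + 2)\<^esub> {var i, var j}"
    if "i \<in> S \<or> j \<in> S" "{i, j} \<subseteq> {1..n}" for i j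
  proof -
    have "S \<subseteq> {1..n + 2}" "{var i, var j} \<subseteq> carrier (QX (n + 2))"
      using assms(2) that by (auto intro!: var_in_carrier)
    then show ?thesis
      using that(1) var_prod_in_genideal[of S "n + 2" _ "{var i, var j}"] by blast
  qed
  have "var_prod S \<in> cycle_cover_ideal n"
    unfolding cycle_cover_ideal_def
  proof (intro IntI INT_I)
    show "var_prod S \<in> Idl\<^bsub>QX (n + 2)\<^esub> {var n, var 1}"
      using assms(1,3) by (intro gen) auto
    show "var_prod S \<in> Idl\<^bsub>QX (n + 2)\<^esub> {var i, var (i + 1)}" if "i \<in> {1..n - 1}" for i
      using assms(1) assms(4)[OF that] that by (intro gen) auto
  qed
  moreover have "0 \<in> cycle_edge_ideal n"
    using additive_subgroup.zero_closed[OF ideal.axioms(1)[OF ideal_cycle_edge_ideal[OF assms(1)]]]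
    by simp
  ultimately show ?thesis
    by (force simp: cycle_sum_ideal_def set_add_def' l_coset_def)
qed

section \<open>The witness and its square\<close>

lemma var_prod_notin_square:
  assumes "n \<ge> 2"
  shows "var_prod {1..n + 2} \<notin> cycle_sum_ideal n \<cdot>\<^bsub>QX (n + 2)\<^esub> cycle_sum_ideal n"
proof
  let ?L = "cycle_sum_ideal n"
  \<comment> \<open>The ideal product is generated inductively by products and sums; sums add no
    monomials, so each monomial factors into monomials of two elements of L.\<close>
  have keys: "\<exists>a b p q. m = a + b \<and> p \<in> ?L \<and> q \<in> ?L \<and> a \<in> Poly_Mapping.keys p \<and> b \<in> Poly_Mapping.keys q"
    if "f \<in> ?L \<cdot>\<^bsub>QX (n + 2)\<^esub> ?L" "m \<in> Poly_Mapping.keys f" for f m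
    using that
  proof (induction)
    case (prod p q)
    then show ?case using Poly_Mapping.keys_mult[of p q] by simp blast
  next
    case (sum p q)
    then show ?case using Poly_Mapping.keys_add[of p q] by simp blast
  qed
  assume g: "var_prod {1..n + 2} \<in> ?L \<cdot>\<^bsub>QX (n + 2)\<^esub> ?L"
  obtain m where m: "Poly_Mapping.keys (var_prod {1..n + 2} :: _ \<Rightarrow>\<^sub>0 rat) = {m}"
      "\<And>i. i \<in> {1..n + 2} \<Longrightarrow> Poly_Mapping.lookup m i = 1"
    by (rule keys_var_prod[OF finite_atLeastAtMost]) blast
  obtain a b p q where ab: "m = a + b" "p \<in> ?L" "q \<in> ?L" "a \<in> Poly_Mapping.keys p" "b \<in> Poly_Mapping.keys q"
    using keys[OF g, of m] m(1) by auto
  have one: "Poly_Mapping.lookup a i + Poly_Mapping.lookup b i = 1" if "i \<in> {1..n + 2}" for i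
    using m(2)[OF that] ab(1) by (simp add: lookup_add)
  have E: "Poly_Mapping.lookup a i + Poly_Mapping.lookup b i = 1 \<and>
      Poly_Mapping.lookup a j + Poly_Mapping.lookup b j = 1" if "(i, j) \<in> cycle_edges n" for i j
    using cycle_edges_bounds[OF assms that] one[of i] one[of j] by simp
  \<comment> \<open>Here \<open>c\<close> contains an edge and \<open>d\<close> covers. At both ends
    of that edge the total exponent 1 is used up by \<open>c\<close>, so \<open>d\<close> vanishes
    there and misses the edge. Separate names \<open>c\<close> and \<open>d\<close> allow both
    orders of the factors.\<close>
  have disjoint: False
    if "(i, j) \<in> cycle_edges n" "Poly_Mapping.lookup c i \<ge> 1" "Poly_Mapping.lookup c j \<ge> 1"
      and "\<forall>(i, j)\<in>cycle_edges n. Poly_Mapping.lookup d i \<ge> 1 \<or> Poly_Mapping.lookup d j \<ge> 1"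
      and "c + d = a + b" for c d i j
  proof -
    have "Poly_Mapping.lookup c k + Poly_Mapping.lookup d k =
        Poly_Mapping.lookup a k + Poly_Mapping.lookup b k" for k
      using that(5) by (metis lookup_add)
    from this[of i] this[of j] show False
      using that(2,3) bspec[OF that(4,1)] E[OF that(1)] by auto
  qed
  \<comment> \<open>Two factors of the same type would give exponent at least 2 to
    \<open>var (n + 1)\<close> or \<open>var (n + 2)\<close>; the mixed cases are settled by
    \<open>disjoint\<close>.\<close>
  from keys_cycle_sum[OF assms ab(2,4)] keys_cycle_sum[OF assms ab(3,5)] show False
  proof (elim disjE conjE bexE case_prodE)
    assume "Poly_Mapping.lookup a (n + 1) \<ge> 1" "Poly_Mapping.lookup b (n + 1) \<ge> 1"
    then show False using one[of "n + 1"] by simp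
  next
    assume "Poly_Mapping.lookup a (n + 2) \<ge> 1" "Poly_Mapping.lookup b (n + 2) \<ge> 1"
    then show False using one[of "n + 2"] by simp
  next
    fix e i j
    assume "e \<in> cycle_edges n" "e = (i, j)" "Poly_Mapping.lookup a i \<ge> 1" "Poly_Mapping.lookup a j \<ge> 1"
      "\<forall>(i, j)\<in>cycle_edges n. Poly_Mapping.lookup b i \<ge> 1 \<or> Poly_Mapping.lookup b j \<ge> 1"
    then show False by (intro disjoint[of i j a b]) simp_all
  next
    fix e i j
    assume "e \<in> cycle_edges n" "e = (i, j)" "Poly_Mapping.lookup b i \<ge> 1" "Poly_Mapping.lookup b j \<ge> 1"
      "\<forall>(i, j)\<in>cycle_edges n. Poly_Mapping.lookup a i \<ge> 1 \<or> Poly_Mapping.lookup a j \<ge> 1"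
    then show False by (intro disjoint[of i j b a]) (simp_all add: add.commute)
  qed
qed

lemma var_prod_square_mem:
  assumes "n \<ge> 4"
  defines "L \<equiv> cycle_sum_ideal n"
  shows "var_prod {1..n + 2} * var_prod {1..n + 2} \<in> (L \<cdot>\<^bsub>QX (n + 2)\<^esub> L) \<cdot>\<^bsub>QX (n + 2)\<^esub> (L \<cdot>\<^bsub>QX (n + 2)\<^esub> L)"
proof -
  define M where "M = (var_prod {5..n} :: _ \<Rightarrow>\<^sub>0 rat)"
  \<comment> \<open>The assumption makes 1, 2, 3, 4 distinct vertices of the cycle; for n = 4 the
    remaining block \<open>{5..n}\<close> is empty.\<close>
  have split: "{1..n + 2} = {1, 2, 3, 4, n + 1, n + 2} \<union> {5..n}"
    using assms(1) by auto
  have g: "var_prod {1..n + 2} = var 1 * var 2 * var 3 * var 4 * var (n + 1) * var (n + 2) * M"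
    unfolding split M_def var_prod_def
    using assms(1) by (subst prod.union_disjoint) (auto simp: ac_simps)
  \<comment> \<open>Both sets are vertex covers: the odd and even choices alternate on the path 1,
    2, 3, 4, and every later vertex is included. The edge closing the cycle is covered by 1 in the
    first set and by n in the second.\<close>
  have c: "var_prod ({1, 3} \<union> {5..n}) = var 1 * var 3 * M"
      "var_prod ({2, 4} \<union> {5..n}) = var 2 * var 4 * M"
    unfolding M_def var_prod_def by (subst prod.union_disjoint; simp)+
  have numerals: "(1::nat) + 1 = 2" "(3::nat) + 1 = 4" by simp_all
  \<comment> \<open>Pairing the two edge elements and the two cover elements exhibits the square as
    a product of two elements of L^2. The sums \<open>1 + 1\<close> and \<open>3 + 1\<close> match
    the form of \<open>edge_in_cycle_sum\<close>.\<close>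
  have "var_prod {1..n + 2} * var_prod {1..n + 2} =
      ((var (n + 1) * (var 1 * var (1 + 1))) * (var (n + 1) * (var 3 * var (3 + 1)))) *
      ((var (n + 2) * var_prod ({1, 3} \<union> {5..n})) *
       (var (n + 2) * var_prod ({2, 4} \<union> {5..n})) :: _ \<Rightarrow>\<^sub>0 rat)"
    unfolding g c numerals by (simp only: mult_ac)
  moreover have "var (n + 1) * (var 1 * var (1 + 1)) \<in> L" "var (n + 1) * (var 3 * var (3 + 1)) \<in> L"
    unfolding L_def by (rule edge_in_cycle_sum; use assms(1) in simp)+
  moreover have "var (n + 2) * var_prod ({1, 3} \<union> {5..n}) \<in> L"
      "var (n + 2) * var_prod ({2, 4} \<union> {5..n}) \<in> L"
    unfolding L_def by (rule cover_in_cycle_sum; use assms(1) in force)+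
  ultimately show ?thesis
    by (metis ideal_prod.prod mpoly_ring_simps(1))
qed

theorem corollary4p2:
  fixes n :: nat
  assumes "n \<ge> 4"
  shows "\<not> normal_ideal (QX (n + 2)) (cycle_sum_ideal n)"
proof
  interpret cring "QX (n + 2)" by (rule cring_mpoly_ring)
  let ?R = "QX (n + 2)"
  let ?L = "cycle_sum_ideal n"
  let ?g = "var_prod {1..n + 2} :: _ \<Rightarrow>\<^sub>0 rat"
  have L: "ideal ?L ?R" using assms by (intro ideal_cycle_sum_ideal) simp
  have g: "?g \<in> carrier ?R" by (rule var_prod_carrier) simp
  have "?g \<otimes>\<^bsub>?R\<^esub> ?g \<in> (?L \<cdot>\<^bsub>?R\<^esub> ?L) \<cdot>\<^bsub>?R\<^esub> (?L \<cdot>\<^bsub>?R\<^esub> ?L)"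
    using var_prod_square_mem[OF assms] by (simp only: mpoly_ring_simps)
  then have "integral_over_ideal ?R (?L \<cdot>\<^bsub>?R\<^esub> ?L) ?g"
    by (rule integral_over_idealI_square[OF ideal_prod_is_ideal[OF L L] g])
  moreover assume "normal_ideal ?R ?L"
  \<comment> \<open>Normality is tested at the exponent t = 2.\<close>
  then have "integrally_closed_ideal ?R (?L \<cdot>\<^bsub>?R\<^esub> ?L)"
    unfolding normal_ideal_def using ideal_power_two[OF L] by (metis one_le_numeral)
  ultimately have "?g \<in> ?L \<cdot>\<^bsub>?R\<^esub> ?L"
    using g unfolding integrally_closed_ideal_def ideal_integral_closure_def by blast
  then show False
    using var_prod_notin_square[of n] assms by simp
qed

end
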